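(* Suppose that the initial data are such that $$\frac14\Big(\|L_N^{1/2}\phi^0\|_2^2+\|L_N^{1/2}(2\phi^0-\phi^{-1})\|_2^2\Big)+\frac12\Big(|r^0|^2+|2r^0-r^{-1}|^2\Big)\le\tilde C_0$$ for some $\tilde C_0$ independent of $h$. Then the solution of the numerical scheme (SAV), given in the context, satisfies the uniform-in-time bound $$\|\phi^m\|_{H_N^2}\le\tilde C_1\qquad\text{for all } m\ge1,$$ where $\tilde C_1>0$ depends on $\Omega$, $\tilde C_0$ (and the fixed parameter $a$), but is independent of $h$, $\Delta t$ and the time step $t^m$.
   Context: Let $\Omega=(0,1)^3$ ($|\Omega|=1$), $N=2K+1$ with $K\in\mathbb N$, $h=1/N$, grid points $(x_i,y_j,z_k)=(ih,jh,kh)$; $\Delta t>0$, $t^m=m\Delta t$. $\mathcal G_N$ is the space of real grid functions $f:\mathbb Z^3\to\mathbb R$ that are $N$-periodic in each index. For $f,g\in\mathcal G_N$: $\langle f,g\rangle=h^3\sum_{i,j,k=0}^{N-1}f_{i,j,k}g_{i,j,k}$, $\|f\|_p=(h^3\sum_{i,j,k=0}^{N-1}|f_{i,j,k}|^p)^{1/p}$ (for vector-valued grid functions $|\cdot|$ is the Euclidean norm). Every $f\in\mathcal G_N$ has the discrete Fourier expansion $f_{i,j,k}=\sum_{\ell,m,n=-K}^K\hat f^N_{\ell,m,n}e^{2\pi\mathrm i(\ell x_i+my_j+nz_k)}$. The Fourier pseudo-spectral derivative $\mathcal D_x$ multiplies $\hat f^N_{\ell,m,n}$ by $2\pi\mathrm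 i\ell$ (similarly $\mathcal D_y,\mathcal D_z$ with $m,n$); $\nabla_N f=(\mathcal D_xf,\mathcal D_yf,\mathcal D_zf)^T$, $\nabla_N\cdot(f_1,f_2,f_3)^T=\mathcal D_xf_1+\mathcal D_yf_2+\mathcal D_zf_3$, $\Delta_N=\nabla_N\cdot\nabla_N$. The discrete $H^2$ norm is $\|f\|_{H_N^2}^2=\|f\|_2^2+\|\nabla_Nf\|_2^2+\|\Delta_Nf\|_2^2$. The constant $a=1-\varepsilon$, $0<\varepsilon<1$, is a fixed parameter, so $0<a<1$. Define $N_N(\phi)=-\nabla_N\cdot(|\nabla_N\phi|^2\nabla_N\phi)+2\Delta_N\phi$ (pointwise products), $L_N\phi=a\phi+\Delta_N^2\phi$, and $E_{1,N}(\phi)=\frac14\|\nabla_N\phi\|_4^4-\|\nabla_N\phi\|_2^2+2|\Omega|$. The operator $L_N^{1/2}$ multiplies $\hat f^N_{\ell,m,n}$ by $(a+\lambda_{\ell,m,n}^2)^{1/2}$, where $\lambda_{\ell,m,n}=4\pi^2(\ell^2+m^2+n^2)$. Scheme (SAV): given $\phi^n,\phi^{n-1}\in\mathcal G_N$ and $r^n,r^{n-1}\in\mathbb R$, with $\hat\phi^{n+1}=2\phi^n-\phi^{n-1}$, find $\phi^{n+1}\in\mathcal G_N$, $r^{n+1}\in\mathbb R$ such that $$\frac{\frac32\phi^{n+1}-2\phi^n+\frac12\phi^{n-1}}{\Delta t}=\Delta_N\Big(\frac{r^{n+1}}{\sqrt{E_{1,N}(\hat\phi^{n+1})}}N_N(\hat\phi^{n+1})+L_N\phi^{n+1}\Big),$$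 $$\frac{\frac32r^{n+1}-2r^n+\frac12r^{n-1}}{\Delta t}=\frac{1}{2\sqrt{E_{1,N}(\hat\phi^{n+1})}}\Big\langle N_N(\hat\phi^{n+1}),\frac{\frac32\phi^{n+1}-2\phi^n+\frac12\phi^{n-1}}{\Delta t}\Big\rangle,$$ for $n\ge0$, started from $\phi^0\in\mathcal G_N$, $\phi^{-1}=\phi^0-\Delta t\,\Delta_N\mu^0$ with $\mu^0=-\nabla_N\cdot(|\nabla_N\phi^0|^2\nabla_N\phi^0)+a\phi^0+2\Delta_N\phi^0+\Delta_N^2\phi^0$, $r^0=\sqrt{E_{1,N}(\phi^0)}$, $r^{-1}=\sqrt{E_{1,N}(\phi^{-1})}$. *)

theory Defs
  imports "HOL-Analysis.Analysis"
begin

section \<open>Periodic grid functions\<close>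

text \<open>Grid indices and Fourier wave numbers are integer triples. A grid function is a function on
  all of \<open>\<int>\<^sup>3\<close>; \<open>N = 2 K + 1\<close>.\<close>

type_synonym idx = "int \<times> int \<times> int"

definition gridN :: "nat \<Rightarrow> int" where
  "gridN K = 2 * int K + 1"

definition mesh :: "nat \<Rightarrow> real" where
  "mesh K = 1 / of_int (gridN K)"

definition grid_coord :: "nat \<Rightarrow> int \<Rightarrow> real" where
  "grid_coord K i = of_int i * mesh K"

definition cell :: "nat \<Rightarrow> idx set" where
  "cell K = {0..gridN K - 1} \<times> {0..gridN K - 1} \<times> {0..gridN K - 1}"

definition modes :: "nat \<Rightarrow> idx set" where
  "modes K = {- int K..int K} \<times> {- int K..int K} \<times> {- int K..int K}"

definition periodic_grid :: "nat \<Rightarrow> (idx \<Rightarrow> 'a) \<Rightarrow> bool" where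
  "periodic_grid K f \<longleftrightarrow> (\<forall>i j k.
     f (i + gridN K, j, k) = f (i, j, k) \<and>
     f (i, j + gridN K, k) = f (i, j, k) \<and>
     f (i, j, k + gridN K) = f (i, j, k))"

definition grid_space :: "nat \<Rightarrow> (idx \<Rightarrow> real) set" where
  "grid_space K = {f. periodic_grid K f}"

definition grid_inner :: "nat \<Rightarrow> (idx \<Rightarrow> real) \<Rightarrow> (idx \<Rightarrow> real) \<Rightarrow> real" where
  "grid_inner K f g = mesh K ^ 3 * (\<Sum>q\<in>cell K. f q * g q)"

text \<open>The norm \<open>\<parallel>f\<parallel>\<^sub>p\<close>, for scalar grid functions and for vector-valued ones (the norm on
  \<open>real ^ 3\<close> is the Euclidean one).\<close>

definition grid_norm :: "nat \<Rightarrow> real \<Rightarrow> (idx \<Rightarrow> 'a::real_normed_vector) \<Rightarrow> real" where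
  "grid_norm K p f = (mesh K ^ 3 * (\<Sum>q\<in>cell K. norm (f q) powr p)) powr (1 / p)"

section \<open>Discrete Fourier expansion and Fourier multipliers\<close>

fun fourier_mode :: "nat \<Rightarrow> idx \<Rightarrow> idx \<Rightarrow> complex" where
  "fourier_mode K (l, m, n) (i, j, k) =
     exp (2 * of_real pi * \<i> * of_real (of_int l * grid_coord K i + of_int m * grid_coord K j
                                          + of_int n * grid_coord K k))"

definition fourier_coeff :: "nat \<Rightarrow> (idx \<Rightarrow> real) \<Rightarrow> idx \<Rightarrow> complex" where
  "fourier_coeff K f \<kappa> =
     of_real (mesh K ^ 3) * (\<Sum>q\<in>cell K. of_real (f q) * cnj (fourier_mode K \<kappa> q))"

text \<open>The operator multiplying the Fourier coefficient at \<open>\<kappa>\<close> by \<open>\<sigma> \<kappa>\<close>. For Hermitian symbols,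
  \<open>\<sigma> (- \<kappa>) = cnj (\<sigma> \<kappa>)\<close>, the sum below is already real and \<open>Re\<close> is a mere type conversion. All
  symbols used below are Hermitian. These claims, and the fact that
  \<open>fourier_coeff\<close> gives the unique coefficients of the discrete Fourier expansion, are
  proved at the end of this theory.\<close>

definition fourier_mult :: "nat \<Rightarrow> (idx \<Rightarrow> complex) \<Rightarrow> (idx \<Rightarrow> real) \<Rightarrow> idx \<Rightarrow> real" where
  "fourier_mult K \<sigma> f q =
     Re (\<Sum>\<kappa>\<in>modes K. \<sigma> \<kappa> * fourier_coeff K f \<kappa> * fourier_mode K \<kappa> q)"

section \<open>Discrete differential operators\<close>

definition Dx_symbol :: "idx \<Rightarrow> complex" where
  "Dx_symbol = (\<lambda>(l, m, n). 2 * of_real pi * \<i> * of_int l)"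

definition Dy_symbol :: "idx \<Rightarrow> complex" where
  "Dy_symbol = (\<lambda>(l, m, n). 2 * of_real pi * \<i> * of_int m)"

definition Dz_symbol :: "idx \<Rightarrow> complex" where
  "Dz_symbol = (\<lambda>(l, m, n). 2 * of_real pi * \<i> * of_int n)"

definition Dx :: "nat \<Rightarrow> (idx \<Rightarrow> real) \<Rightarrow> idx \<Rightarrow> real" where
  "Dx K = fourier_mult K Dx_symbol"

definition Dy :: "nat \<Rightarrow> (idx \<Rightarrow> real) \<Rightarrow> idx \<Rightarrow> real" where
  "Dy K = fourier_mult K Dy_symbol"

definition Dz :: "nat \<Rightarrow> (idx \<Rightarrow> real) \<Rightarrow> idx \<Rightarrow> real" where
  "Dz K = fourier_mult K Dz_symbol"

definition grad_N :: "nat \<Rightarrow> (idx \<Rightarrow> real) \<Rightarrow> idx \<Rightarrow> real ^ 3" where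
  "grad_N K f q = vector [Dx K f q, Dy K f q, Dz K f q]"

definition div_N :: "nat \<Rightarrow> (idx \<Rightarrow> real ^ 3) \<Rightarrow> idx \<Rightarrow> real" where
  "div_N K F q = Dx K (\<lambda>p. F p $ 1) q + Dy K (\<lambda>p. F p $ 2) q + Dz K (\<lambda>p. F p $ 3) q"

definition lap_N :: "nat \<Rightarrow> (idx \<Rightarrow> real) \<Rightarrow> idx \<Rightarrow> real" where
  "lap_N K f = div_N K (grad_N K f)"

definition H2_norm :: "nat \<Rightarrow> (idx \<Rightarrow> real) \<Rightarrow> real" where
  "H2_norm K f =
     sqrt ((grid_norm K 2 f)\<^sup>2 + (grid_norm K 2 (grad_N K f))\<^sup>2 + (grid_norm K 2 (lap_N K f))\<^sup>2)"

section \<open>The SAV scheme\<close>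

text \<open>The term \<open>\<nabla>\<^sub>N \<cdot> (|\<nabla>\<^sub>N \<phi>|\<^sup>2 \<nabla>\<^sub>N \<phi>)\<close>.\<close>

definition div_cubic :: "nat \<Rightarrow> (idx \<Rightarrow> real) \<Rightarrow> idx \<Rightarrow> real" where
  "div_cubic K \<phi> = div_N K (\<lambda>q. (norm (grad_N K \<phi> q))\<^sup>2 *\<^sub>R grad_N K \<phi> q)"

definition N_N :: "nat \<Rightarrow> (idx \<Rightarrow> real) \<Rightarrow> idx \<Rightarrow> real" where
  "N_N K \<phi> q = - div_cubic K \<phi> q + 2 * lap_N K \<phi> q"

definition L_N :: "nat \<Rightarrow> real \<Rightarrow> (idx \<Rightarrow> real) \<Rightarrow> idx \<Rightarrow> real" where
  "L_N K a \<phi> q = a * \<phi> q + lap_N K (lap_N K \<phi>) q"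

definition lap_eigenvalue :: "idx \<Rightarrow> real" where
  "lap_eigenvalue = (\<lambda>(l, m, n). 4 * pi\<^sup>2 * of_int (l\<^sup>2 + m\<^sup>2 + n\<^sup>2))"

definition L_N_sqrt_symbol :: "real \<Rightarrow> idx \<Rightarrow> complex" where
  "L_N_sqrt_symbol a \<kappa> = of_real (sqrt (a + (lap_eigenvalue \<kappa>)\<^sup>2))"

definition L_N_sqrt :: "nat \<Rightarrow> real \<Rightarrow> (idx \<Rightarrow> real) \<Rightarrow> idx \<Rightarrow> real" where
  "L_N_sqrt K a = fourier_mult K (L_N_sqrt_symbol a)"

text \<open>The domain \<open>\<Omega>\<close> is the open unit cube, so \<open>|\<Omega>| = 1\<close>.\<close>

definition Omega :: "(real ^ 3) set" where
  "Omega = box 0 1"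

lemma measure_Omega: "measure lborel Omega = 1"
proof -
  have "(\<Prod>b\<in>Basis. (1 - 0 :: real ^ 3) \<bullet> b) = 1"
  proof (rule prod.neutral, rule ballI)
    fix b :: "real ^ 3" assume "b \<in> Basis"
    then obtain i where "b = axis i 1" by (auto simp: Basis_vec_def)
    then show "(1 - 0 :: real ^ 3) \<bullet> b = 1" by (simp add: inner_axis)
  qed
  moreover have "(0 :: real ^ 3) \<bullet> b \<le> 1 \<bullet> b" if "b \<in> Basis" for b
    using that by (auto simp: Basis_vec_def inner_axis)
  ultimately show ?thesis
    unfolding Omega_def by (subst measure_lborel_box) auto
qed

definition E1_N :: "nat \<Rightarrow> (idx \<Rightarrow> real) \<Rightarrow> real" where
  "E1_N K \<phi> = 1 / 4 * grid_norm K 4 (grad_N K \<phi>) ^ 4 - (grid_norm K 2 (grad_N K \<phi>))\<^sup>2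
              + 2 * measure lborel Omega"

definition chem_pot :: "nat \<Rightarrow> real \<Rightarrow> (idx \<Rightarrow> real) \<Rightarrow> idx \<Rightarrow> real" where
  "chem_pot K a \<phi> q =
     - div_cubic K \<phi> q + a * \<phi> q + 2 * lap_N K \<phi> q + lap_N K (lap_N K \<phi>) q"

text \<open>The sequences are indexed by the integers: the time level \<open>-1\<close> is the index \<open>-1\<close>; values at
  indices below \<open>-1\<close> are irrelevant.\<close>

definition sav_start :: "nat \<Rightarrow> real \<Rightarrow> real \<Rightarrow> (int \<Rightarrow> idx \<Rightarrow> real) \<Rightarrow> (int \<Rightarrow> real) \<Rightarrow> bool" where
  "sav_start K a dt \<phi> r \<longleftrightarrow>
     \<phi> 0 \<in> grid_space K \<and>
     (\<forall>q. \<phi> (-1) q = \<phi> 0 q - dt * lap_N K (chem_pot K a (\<phi> 0)) q) \<and>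
     r 0 = sqrt (E1_N K (\<phi> 0)) \<and>
     r (-1) = sqrt (E1_N K (\<phi> (-1)))"

definition extrap :: "(int \<Rightarrow> idx \<Rightarrow> real) \<Rightarrow> int \<Rightarrow> idx \<Rightarrow> real" where
  "extrap \<phi> n q = 2 * \<phi> n q - \<phi> (n - 1) q"

definition bdf2 :: "real \<Rightarrow> (int \<Rightarrow> idx \<Rightarrow> real) \<Rightarrow> int \<Rightarrow> idx \<Rightarrow> real" where
  "bdf2 dt \<phi> n q = (3 / 2 * \<phi> (n + 1) q - 2 * \<phi> n q + 1 / 2 * \<phi> (n - 1) q) / dt"

definition sav_step ::
    "nat \<Rightarrow> real \<Rightarrow> real \<Rightarrow> (int \<Rightarrow> idx \<Rightarrow> real) \<Rightarrow> (int \<Rightarrow> real) \<Rightarrow> int \<Rightarrow> bool" where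
  "sav_step K a dt \<phi> r n \<longleftrightarrow>
     \<phi> (n + 1) \<in> grid_space K \<and>
     (\<forall>q. bdf2 dt \<phi> n q =
          lap_N K (\<lambda>p. r (n + 1) / sqrt (E1_N K (extrap \<phi> n)) * N_N K (extrap \<phi> n) p
                       + L_N K a (\<phi> (n + 1)) p) q) \<and>
     (3 / 2 * r (n + 1) - 2 * r n + 1 / 2 * r (n - 1)) / dt =
       1 / (2 * sqrt (E1_N K (extrap \<phi> n))) * grid_inner K (N_N K (extrap \<phi> n)) (bdf2 dt \<phi> n)"

definition sav_solution ::
    "nat \<Rightarrow> real \<Rightarrow> real \<Rightarrow> (int \<Rightarrow> idx \<Rightarrow> real) \<Rightarrow> (int \<Rightarrow> real) \<Rightarrow> bool" where
  "sav_solution K a dt \<phi> r \<longleftrightarrow> sav_start K a dt \<phi> r \<and> (\<forall>n\<ge>0. sav_step K a dt \<phi> r n)"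

section \<open>Properties of the discrete Fourier expansion\<close>

declare fourier_mode.simps [simp del]

lemma gridN_pos: "gridN K > 0"
  by (simp add: gridN_def)

lemma finite_modes [simp]: "finite (modes K)"
  by (simp add: modes_def)

lemma finite_cell [simp]: "finite (cell K)"
  by (simp add: cell_def)

definition root_N :: "nat \<Rightarrow> int \<Rightarrow> complex" where
  "root_N K d = cis (2 * pi * of_int d / of_int (gridN K))"

lemma root_N_add: "root_N K (c + d) = root_N K c * root_N K d"
  by (simp add: root_N_def cis_mult add_divide_distrib distrib_left)

lemma root_N_uminus: "root_N K (- d) = cnj (root_N K d)"
  by (simp add: root_N_def cis_cnj)

lemma root_N_diff: "root_N K (c - d) = root_N K c * cnj (root_N K d)"
  using root_N_add[of K c "- d"] by (simp add: root_N_uminus)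

lemma root_N_period: "root_N K (gridN K * d) = 1"
proof -
  have "2 * pi * of_int (gridN K * d) / of_int (gridN K) = 2 * pi * of_int d"
    using gridN_pos[of K] by simp
  then show ?thesis unfolding root_N_def by (simp only: cis_multiple_2pi Ints_of_int)
qed

lemma root_N_eq_1_iff: "root_N K d = 1 \<longleftrightarrow> gridN K dvd d"
proof
  assume "root_N K d = 1"
  then have "cos (2 * pi * of_int d / of_int (gridN K)) = 1"
    by (simp add: root_N_def complex_eq_iff)
  then obtain x :: int where "2 * pi * of_int d / of_int (gridN K) = of_int x * 2 * pi"
    by (auto simp: cos_one_2pi_int)
  then have "real_of_int d = of_int (x * gridN K)"
    using gridN_pos[of K] by (simp add: field_simps)
  then have "d = x * gridN K" by (simp only: of_int_eq_iff)
  then show "gridN K dvd d" by simp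
qed (auto simp: root_N_period)

lemma sum_root_N:
  assumes "c = b + gridN K - 1"
  shows "(\<Sum>i\<in>{b..c}. root_N K (i * d)) = (if gridN K dvd d then of_int (gridN K) else 0)"
proof (cases "gridN K dvd d")
  case True
  then have "root_N K (i * d) = 1" for i by (simp add: root_N_eq_1_iff)
  then show ?thesis using True gridN_pos[of K] assms by simp
next
  case False
  let ?S = "\<Sum>i\<in>{b..c}. root_N K (i * d)"
  have "root_N K d * ?S = (\<Sum>i\<in>{b..c}. root_N K ((i + 1) * d))"
    unfolding sum_distrib_left
    by (rule sum.cong[OF refl]) (simp only: distrib_right mult_1_left root_N_add, rule mult.commute)
  also have "\<dots> = (\<Sum>i\<in>{b + 1..c + 1}. root_N K (i * d))"
    by (rule sum.reindex_bij_witness[of _ "\<lambda>i. i - 1" "\<lambda>i. i + 1"]) auto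
  also have "\<dots> = ?S"
  proof -
    have 1: "{b..c} = insert b {b + 1..c}" and 2: "{b + 1..c + 1} = insert (c + 1) {b + 1..c}"
      using assms gridN_pos[of K] by auto
    have "(c + 1) * d = b * d + gridN K * d" using assms by (simp add: algebra_simps)
    then have "root_N K ((c + 1) * d) = root_N K (b * d)"
      by (simp only: root_N_add root_N_period mult_1_right)
    then show ?thesis unfolding 1 2 by simp
  qed
  finally have "(root_N K d - 1) * ?S = 0" by (simp add: algebra_simps)
  then show ?thesis using False by (simp add: root_N_eq_1_iff)
qed

lemma fourier_mode_root:
  "fourier_mode K (l, m, n) (i, j, k) = root_N K (l * i) * root_N K (m * j) * root_N K (n * k)"
  by (simp flip: root_N_add)
     (simp add: fourier_mode.simps root_N_def grid_coord_def mesh_def cis_conv_exp algebra_simps add_divide_distrib)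

lemma sum_modes:
  "(\<Sum>\<kappa>\<in>modes K. fourier_mode K \<kappa> (i, j, k) * cnj (fourier_mode K \<kappa> (i', j', k'))) =
     (if gridN K dvd i - i' \<and> gridN K dvd j - j' \<and> gridN K dvd k - k'
      then of_int (gridN K) ^ 3 else 0)"
proof -
  let ?I = "{- int K..int K}"
  have eq: "fourier_mode K (l, m, n) (i, j, k) * cnj (fourier_mode K (l, m, n) (i', j', k')) =
      root_N K (l * (i - i')) * (root_N K (m * (j - j')) * root_N K (n * (k - k')))" for l m n
    by (simp add: fourier_mode_root right_diff_distrib root_N_diff mult_ac)
  have "(\<Sum>\<kappa>\<in>modes K. fourier_mode K \<kappa> (i, j, k) * cnj (fourier_mode K \<kappa> (i', j', k'))) =
      (\<Sum>l\<in>?I. root_N K (l * (i - i'))) *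
        ((\<Sum>m\<in>?I. root_N K (m * (j - j'))) * (\<Sum>n\<in>?I. root_N K (n * (k - k'))))"
    unfolding modes_def sum_product sum.cartesian_product
    by (rule sum.cong) (auto simp: eq)
  then show ?thesis
    by (simp add: sum_root_N gridN_def power3_eq_cube)
qed

lemma sum_cell:
  "(\<Sum>q\<in>cell K. fourier_mode K (l, m, n) q * cnj (fourier_mode K (l', m', n') q)) =
     (if gridN K dvd l - l' \<and> gridN K dvd m - m' \<and> gridN K dvd n - n'
      then of_int (gridN K) ^ 3 else 0)"
proof -
  let ?I = "{0..gridN K - 1}"
  have eq: "fourier_mode K (l, m, n) (i, j, k) * cnj (fourier_mode K (l', m', n') (i, j, k)) =
      root_N K (i * (l - l')) * (root_N K (j * (m - m')) * root_N K (k * (n - n')))" for i j k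
    by (simp add: fourier_mode_root right_diff_distrib root_N_diff mult_ac)
  have "(\<Sum>q\<in>cell K. fourier_mode K (l, m, n) q * cnj (fourier_mode K (l', m', n') q)) =
      (\<Sum>i\<in>?I. root_N K (i * (l - l'))) *
        ((\<Sum>j\<in>?I. root_N K (j * (m - m'))) * (\<Sum>k\<in>?I. root_N K (k * (n - n'))))"
    unfolding cell_def sum_product sum.cartesian_product
    by (rule sum.cong) (auto simp: eq)
  then show ?thesis
    by (simp add: sum_root_N power3_eq_cube)
qed

lemma sum_cell_modes:
  assumes "\<kappa> \<in> modes K" "\<kappa>' \<in> modes K"
  shows "(\<Sum>q\<in>cell K. fourier_mode K \<kappa> q * cnj (fourier_mode K \<kappa>' q)) =
           (if \<kappa> = \<kappa>' then of_int (gridN K) ^ 3 else 0)"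
proof -
  have *: "gridN K dvd l - l' \<longleftrightarrow> l = l'"
    if "l \<in> {- int K..int K}" "l' \<in> {- int K..int K}" for l l'
  proof
    assume dvd: "gridN K dvd l - l'"
    have "\<bar>l - l'\<bar> < gridN K" using that by (auto simp: gridN_def)
    with dvd show "l = l'" using dvd_imp_le_int[of "l - l'" "gridN K"] gridN_pos[of K] by auto
  qed auto
  obtain l m n l' m' n' where "\<kappa> = (l, m, n)" "\<kappa>' = (l', m', n')"
    by (cases \<kappa>; cases \<kappa>') auto
  with assms show ?thesis
    by (simp only: sum_cell) (auto simp: modes_def *)
qed

lemma mesh_gridN: "complex_of_real (mesh K ^ 3) * of_int (gridN K) ^ 3 = 1"
proof -
  have "complex_of_int (gridN K) \<noteq> 0" using gridN_pos[of K] by simp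
  then show ?thesis by (simp add: mesh_def power_divide field_simps)
qed

lemma periodic_grid_shift:
  assumes "periodic_grid K f"
  shows "f (i mod gridN K, j mod gridN K, k mod gridN K) = f (i, j, k)"
proof -
  have nat_shift: "g (x + int n * p) = g x" if "\<And>x. g (x + p) = g x" for g :: "int \<Rightarrow> 'a" and n x p
  proof (induction n)
    case (Suc n)
    have "x + int (Suc n) * p = (x + int n * p) + p" by (simp add: algebra_simps)
    then show ?case using Suc that by metis
  qed simp
  have per: "g (x mod p) = g x" if g: "\<And>x. g (x + p) = g x" for g :: "int \<Rightarrow> 'a" and x p
  proof (cases "x div p \<ge> 0")
    case True
    then show ?thesis
      using nat_shift[of g p "x mod p" "nat (x div p)", OF g]
      by (simp add: algebra_simps)
  next
    case False
    then show ?thesis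
      using nat_shift[of g p x "nat (- (x div p))", OF g] minus_mult_div_eq_mod[of x p]
      by (simp add: algebra_simps)
  qed
  have "f (i mod gridN K, j mod gridN K, k mod gridN K) = f (i, j mod gridN K, k mod gridN K)"
    using per[of "\<lambda>x. f (x, j mod gridN K, k mod gridN K)" "gridN K" i] assms
    by (auto simp: periodic_grid_def)
  also have "\<dots> = f (i, j, k mod gridN K)"
    using per[of "\<lambda>x. f (i, x, k mod gridN K)" "gridN K" j] assms
    by (auto simp: periodic_grid_def)
  also have "\<dots> = f (i, j, k)"
    using per[of "\<lambda>x. f (i, j, x)" "gridN K" k] assms
    by (auto simp: periodic_grid_def)
  finally show ?thesis .
qed

theorem fourier_expansion:
  assumes "f \<in> grid_space K"
  shows "complex_of_real (f q) = (\<Sum>\<kappa>\<in>modes K. fourier_coeff K f \<kappa> * fourier_mode K \<kappa> q)"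
proof -
  obtain i j k where q: "q = (i, j, k)" by (cases q) auto
  let ?N = "gridN K"
  let ?q = "(i mod ?N, j mod ?N, k mod ?N)"
  have dvd_iff: "?N dvd x - y \<longleftrightarrow> y = x mod ?N" if "y \<in> {0..?N - 1}" for x y
    using that gridN_pos[of K] by (auto simp: mod_eq_dvd_iff[symmetric])
  have qc: "?q \<in> cell K" using gridN_pos[of K] by (simp add: cell_def)
  have in_cell: "(\<Sum>\<kappa>\<in>modes K. fourier_mode K \<kappa> q * cnj (fourier_mode K \<kappa> p)) =
      (if p = ?q then of_int ?N ^ 3 else 0)" if p: "p \<in> cell K" for p
  proof -
    obtain i' j' k' where "p = (i', j', k')" by (cases p) auto
    with p show ?thesis
      by (simp only: q sum_modes) (auto simp: cell_def dvd_iff)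
  qed
  have "(\<Sum>\<kappa>\<in>modes K. fourier_coeff K f \<kappa> * fourier_mode K \<kappa> q) =
      (\<Sum>\<kappa>\<in>modes K. \<Sum>p\<in>cell K. of_real (mesh K ^ 3) * of_real (f p) *
         (fourier_mode K \<kappa> q * cnj (fourier_mode K \<kappa> p)))"
    by (simp add: fourier_coeff_def sum_distrib_left sum_distrib_right mult_ac)
  also have "\<dots> = (\<Sum>p\<in>cell K. of_real (mesh K ^ 3) * of_real (f p) *
      (\<Sum>\<kappa>\<in>modes K. fourier_mode K \<kappa> q * cnj (fourier_mode K \<kappa> p)))"
    by (subst sum.swap) (simp add: sum_distrib_left)
  also have "\<dots> = (\<Sum>p\<in>cell K. if p = ?q then of_real (f p) else 0)"
  proof (rule sum.cong[OF refl])
    fix p assume "p \<in> cell K"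
    then show "complex_of_real (mesh K ^ 3) * of_real (f p) *
        (\<Sum>\<kappa>\<in>modes K. fourier_mode K \<kappa> q * cnj (fourier_mode K \<kappa> p)) =
        (if p = ?q then of_real (f p) else 0)"
      using mesh_gridN[of K] by (simp only: in_cell) (simp add: mult_ac)
  qed
  also have "\<dots> = of_real (f ?q)"
    using qc by simp
  also have "f ?q = f q"
    using assms periodic_grid_shift[of K f] by (simp add: q grid_space_def)
  finally show ?thesis by simp
qed

theorem fourier_coeff_unique:
  assumes f: "\<And>q. complex_of_real (f q) = (\<Sum>\<kappa>\<in>modes K. c \<kappa> * fourier_mode K \<kappa> q)"
    and \<kappa>: "\<kappa> \<in> modes K"
  shows "fourier_coeff K f \<kappa> = c \<kappa>"
proof -
  have "fourier_coeff K f \<kappa> = of_real (mesh K ^ 3) *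
      (\<Sum>q\<in>cell K. \<Sum>\<kappa>'\<in>modes K. c \<kappa>' * (fourier_mode K \<kappa>' q * cnj (fourier_mode K \<kappa> q)))"
    by (simp only: fourier_coeff_def f sum_distrib_right mult.assoc)
  also have "\<dots> = of_real (mesh K ^ 3) *
      (\<Sum>\<kappa>'\<in>modes K. c \<kappa>' * (\<Sum>q\<in>cell K. fourier_mode K \<kappa>' q * cnj (fourier_mode K \<kappa> q)))"
    by (subst sum.swap) (simp add: sum_distrib_left)
  also have "\<dots> = of_real (mesh K ^ 3) *
      (\<Sum>\<kappa>'\<in>modes K. if \<kappa>' = \<kappa> then c \<kappa> * of_int (gridN K) ^ 3 else 0)"
    using \<kappa> by (intro arg_cong2[where f = "(*)"] sum.cong refl) (simp only: sum_cell_modes, simp)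
  also have "\<dots> = c \<kappa>"
    using \<kappa> mesh_gridN[of K] by (simp add: mult_ac)
  finally show ?thesis .
qed

definition hermitian_symbol :: "(idx \<Rightarrow> complex) \<Rightarrow> bool" where
  "hermitian_symbol \<sigma> \<longleftrightarrow> (\<forall>l m n. \<sigma> (- l, - m, - n) = cnj (\<sigma> (l, m, n)))"

lemma hermitian_symbols:
  "hermitian_symbol Dx_symbol" "hermitian_symbol Dy_symbol" "hermitian_symbol Dz_symbol"
  "hermitian_symbol (L_N_sqrt_symbol a)"
  by (auto simp: hermitian_symbol_def Dx_symbol_def Dy_symbol_def Dz_symbol_def
                 L_N_sqrt_symbol_def lap_eigenvalue_def)

theorem fourier_mult_expansion:
  assumes "hermitian_symbol \<sigma>"
  shows "complex_of_real (fourier_mult K \<sigma> f q) =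
           (\<Sum>\<kappa>\<in>modes K. \<sigma> \<kappa> * fourier_coeff K f \<kappa> * fourier_mode K \<kappa> q)"
proof -
  let ?t = "\<lambda>\<kappa>. \<sigma> \<kappa> * fourier_coeff K f \<kappa> * fourier_mode K \<kappa> q"
  let ?neg = "\<lambda>(l, m, n). (- l, - m, - n) :: idx"
  have mode: "fourier_mode K (?neg \<kappa>) p = cnj (fourier_mode K \<kappa> p)" for \<kappa> p
    by (cases \<kappa>; cases p) (simp add: fourier_mode_root root_N_uminus)
  have coeff: "fourier_coeff K f (?neg \<kappa>) = cnj (fourier_coeff K f \<kappa>)" for \<kappa>
    unfolding fourier_coeff_def mode by simp
  have "?t (?neg \<kappa>) = cnj (?t \<kappa>)" for \<kappa>
    unfolding mode coeff using assms by (cases \<kappa>) (simp add: hermitian_symbol_def)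
  then have "cnj (\<Sum>\<kappa>\<in>modes K. ?t \<kappa>) = (\<Sum>\<kappa>\<in>modes K. ?t (?neg \<kappa>))"
    by (simp only: cnj_sum)
  also have "\<dots> = (\<Sum>\<kappa>\<in>modes K. ?t \<kappa>)"
    by (rule sum.reindex_bij_witness[of _ ?neg ?neg]) (auto simp: modes_def)
  finally have "(\<Sum>\<kappa>\<in>modes K. ?t \<kappa>) \<in> \<real>"
    by (simp only: Reals_cnj_iff)
  then show ?thesis
    unfolding fourier_mult_def by (rule of_real_Re)
qed

theorem fourier_coeff_mult:
  assumes "hermitian_symbol \<sigma>" "\<kappa> \<in> modes K"
  shows "fourier_coeff K (fourier_mult K \<sigma> f) \<kappa> = \<sigma> \<kappa> * fourier_coeff K f \<kappa>"
  using assms by (intro fourier_coeff_unique fourier_mult_expansion)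

end

theory Submission
  imports Defs
begin

text \<open>
  The scheme dissipates the modified energy
  \<open>E\<^sup>n = (\<parallel>L\<^sup>1\<^sup>/\<^sup>2 \<phi>\<^sup>n\<parallel>\<^sup>2 + \<parallel>L\<^sup>1\<^sup>/\<^sup>2 (2 \<phi>\<^sup>n - \<phi>\<^sup>n\<^sup>-\<^sup>1)\<parallel>\<^sup>2) / 4 + (|r\<^sup>n|\<^sup>2 + |2 r\<^sup>n - r\<^sup>n\<^sup>-\<^sup>1|\<^sup>2) / 2\<close>,
  whose value at \<open>n = 0\<close> is what the hypothesis bounds by \<open>C0\<close>. Indeed, let \<open>w\<close> be the BDF2
  difference quotient of \<open>\<phi>\<close> and \<open>\<mu>\<close> the discrete chemical potential, so that
  \<open>w = \<Delta>\<^sub>N \<mu>\<close>. Then \<open>\<langle>\<mu>, w\<rangle> = \<langle>\<mu>, \<Delta>\<^sub>N \<mu>\<rangle> \<le> 0\<close>. Expanding \<open>\<mu>\<close>, the nonlinear contribution to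
  \<open>\<langle>\<mu>, w\<rangle>\<close> is, by the equation for the auxiliary variable, \<open>2 r\<^sup>n\<^sup>+\<^sup>1\<close> times the difference quotient
  of \<open>r\<close>, and the linear contribution is the inner product of \<open>L\<^sup>1\<^sup>/\<^sup>2 \<phi>\<^sup>n\<^sup>+\<^sup>1\<close> with the
  difference quotient of \<open>L\<^sup>1\<^sup>/\<^sup>2 \<phi>\<close>. The G-stability of BDF2 (lemma \<open>bdf2_gstable\<close>) bounds the sum
  of both from below by \<open>(E\<^sup>n\<^sup>+\<^sup>1 - E\<^sup>n) / \<Delta>t\<close>.

  Hence \<open>\<parallel>L\<^sup>1\<^sup>/\<^sup>2 \<phi>\<^sup>m\<parallel>\<^sup>2 \<le> 4 C0\<close> for all \<open>m\<close>. This controls the discrete \<open>H\<^sup>2\<close> norm: on the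
  Fourier side the squared norms have the symbols \<open>a + \<lambda>\<^sup>2\<close> and \<open>1 + \<lambda> + \<lambda>\<^sup>2\<close>, and the second is
  at most \<open>3 / (2 a)\<close> times the first because \<open>a \<le> 1\<close>. Neither the mesh width nor the time
  step enters the constants.
\<close>

section \<open>Fourier multipliers and the discrete inner product\<close>

lemma grid_norm_2_squared:
  "(grid_norm K 2 f)\<^sup>2 = mesh K ^ 3 * (\<Sum>q\<in>cell K. (norm (f q))\<^sup>2)"
proof -
  have "0 \<le> mesh K" using gridN_pos[of K] by (simp add: mesh_def)
  then show ?thesis
    by (simp add: grid_norm_def powr_half_sqrt sum_nonneg)
qed

lemma grid_norm_2_inner: "(grid_norm K 2 f)\<^sup>2 = grid_inner K f f"
  by (simp add: grid_norm_2_squared grid_inner_def flip: power2_eq_square)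

lemma grid_inner_lincomb_left:
  "grid_inner K (\<lambda>q. c * f q + d * g q) w = c * grid_inner K f w + d * grid_inner K g w"
  by (simp add: grid_inner_def sum.distrib sum_distrib_left distrib_left distrib_right mult_ac)

lemma fourier_coeff_lincomb:
  "fourier_coeff K (\<lambda>q. c * f q + d * g q) \<kappa> =
     of_real c * fourier_coeff K f \<kappa> + of_real d * fourier_coeff K g \<kappa>"
  by (simp add: fourier_coeff_def sum.distrib sum_distrib_left distrib_left distrib_right mult_ac)

lemma fourier_mult_lincomb:
  "fourier_mult K \<sigma> (\<lambda>q. c * f q + d * g q) q =
     c * fourier_mult K \<sigma> f q + d * fourier_mult K \<sigma> g q"
proof -
  have "(\<Sum>\<kappa>\<in>modes K. \<sigma> \<kappa> * fourier_coeff K (\<lambda>q. c * f q + d * g q) \<kappa> * fourier_mode K \<kappa> q) =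
      of_real c * (\<Sum>\<kappa>\<in>modes K. \<sigma> \<kappa> * fourier_coeff K f \<kappa> * fourier_mode K \<kappa> q) +
      of_real d * (\<Sum>\<kappa>\<in>modes K. \<sigma> \<kappa> * fourier_coeff K g \<kappa> * fourier_mode K \<kappa> q)"
    by (simp add: fourier_coeff_lincomb sum.distrib sum_distrib_left algebra_simps)
  then show ?thesis by (simp add: fourier_mult_def)
qed

lemma fourier_mult_one:
  assumes "f \<in> grid_space K"
  shows "fourier_mult K (\<lambda>_. 1) f = f"
proof
  fix q
  show "fourier_mult K (\<lambda>_. 1) f q = f q"
    using fourier_expansion[OF assms, of q, symmetric] by (simp add: fourier_mult_def)
qed

lemma fourier_mult_compose:
  assumes "hermitian_symbol \<sigma>"
  shows "fourier_mult K \<tau> (fourier_mult K \<sigma> f) = fourier_mult K (\<lambda>\<kappa>. \<tau> \<kappa> * \<sigma> \<kappa>) f"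
proof
  fix q
  have "(\<Sum>\<kappa>\<in>modes K. \<tau> \<kappa> * fourier_coeff K (fourier_mult K \<sigma> f) \<kappa> * fourier_mode K \<kappa> q) =
      (\<Sum>\<kappa>\<in>modes K. \<tau> \<kappa> * \<sigma> \<kappa> * fourier_coeff K f \<kappa> * fourier_mode K \<kappa> q)"
    by (rule sum.cong[OF refl]) (simp add: fourier_coeff_mult[OF assms] mult.assoc)
  then show "fourier_mult K \<tau> (fourier_mult K \<sigma> f) q = fourier_mult K (\<lambda>\<kappa>. \<tau> \<kappa> * \<sigma> \<kappa>) f q"
    by (simp add: fourier_mult_def)
qed

lemma fourier_mult_symbol_lincomb:
  "fourier_mult K (\<lambda>\<kappa>. of_real c * \<sigma> \<kappa> + \<tau> \<kappa>) f q =
     c * fourier_mult K \<sigma> f q + fourier_mult K \<tau> f q"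
proof -
  have "(\<Sum>\<kappa>\<in>modes K. (of_real c * \<sigma> \<kappa> + \<tau> \<kappa>) * fourier_coeff K f \<kappa> * fourier_mode K \<kappa> q) =
      of_real c * (\<Sum>\<kappa>\<in>modes K. \<sigma> \<kappa> * fourier_coeff K f \<kappa> * fourier_mode K \<kappa> q) +
      (\<Sum>\<kappa>\<in>modes K. \<tau> \<kappa> * fourier_coeff K f \<kappa> * fourier_mode K \<kappa> q)"
    by (simp add: sum.distrib sum_distrib_left algebra_simps)
  then show ?thesis by (simp add: fourier_mult_def)
qed

text \<open>Plancherel's identity with a multiplier. Pairing the Fourier sum with \<open>g\<close> and exchanging the
  two finite sums turns each mode into the conjugate coefficient of \<open>g\<close>.\<close>

lemma grid_inner_fourier_mult:
  "grid_inner K (fourier_mult K \<sigma> f) g =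
     Re (\<Sum>\<kappa>\<in>modes K. \<sigma> \<kappa> * fourier_coeff K f \<kappa> * cnj (fourier_coeff K g \<kappa>))"
proof -
  have "(\<Sum>\<kappa>\<in>modes K. \<sigma> \<kappa> * fourier_coeff K f \<kappa> * cnj (fourier_coeff K g \<kappa>)) =
      (\<Sum>\<kappa>\<in>modes K. \<Sum>q\<in>cell K. of_real (mesh K ^ 3 * g q) *
         (\<sigma> \<kappa> * fourier_coeff K f \<kappa> * fourier_mode K \<kappa> q))"
    unfolding fourier_coeff_def[of K g]
    by (simp add: sum_distrib_left mult_ac)
  also have "\<dots> = (\<Sum>q\<in>cell K. of_real (mesh K ^ 3 * g q) *
      (\<Sum>\<kappa>\<in>modes K. \<sigma> \<kappa> * fourier_coeff K f \<kappa> * fourier_mode K \<kappa> q))"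
    by (subst sum.swap) (simp only: sum_distrib_left)
  finally have "Re (\<Sum>\<kappa>\<in>modes K. \<sigma> \<kappa> * fourier_coeff K f \<kappa> * cnj (fourier_coeff K g \<kappa>)) =
      (\<Sum>q\<in>cell K. mesh K ^ 3 * g q * fourier_mult K \<sigma> f q)"
    by (simp add: fourier_mult_def del: of_real_mult of_real_power)
  then show ?thesis
    by (simp add: grid_inner_def sum_distrib_left mult_ac)
qed

lemma grid_norm_fourier_mult:
  assumes "hermitian_symbol \<sigma>"
  shows "(grid_norm K 2 (fourier_mult K \<sigma> f))\<^sup>2 =
           (\<Sum>\<kappa>\<in>modes K. (cmod (\<sigma> \<kappa>))\<^sup>2 * (cmod (fourier_coeff K f \<kappa>))\<^sup>2)"
proof -
  have "(\<Sum>\<kappa>\<in>modes K. \<sigma> \<kappa> * fourier_coeff K f \<kappa> *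
        cnj (fourier_coeff K (fourier_mult K \<sigma> f) \<kappa>)) =
      of_real (\<Sum>\<kappa>\<in>modes K. (cmod (\<sigma> \<kappa>))\<^sup>2 * (cmod (fourier_coeff K f \<kappa>))\<^sup>2)"
    unfolding of_real_sum
    by (rule sum.cong[OF refl])
       (simp only: fourier_coeff_mult[OF assms] complex_norm_square[symmetric] norm_mult
          power_mult_distrib)
  then show ?thesis
    by (simp add: grid_norm_2_inner grid_inner_fourier_mult)
qed

section \<open>The operators of the scheme as multipliers\<close>

lemma lap_eigenvalue_nonneg: "0 \<le> lap_eigenvalue \<kappa>"
  by (cases \<kappa>) (simp add: lap_eigenvalue_def)

lemma hermitian_lap: "hermitian_symbol (\<lambda>\<kappa>. - of_real (lap_eigenvalue \<kappa>))"
  by (simp add: hermitian_symbol_def lap_eigenvalue_def)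

lemma lap_N_fourier_mult: "lap_N K f = fourier_mult K (\<lambda>\<kappa>. - of_real (lap_eigenvalue \<kappa>)) f"
proof
  fix q
  have symbol: "- of_real (lap_eigenvalue \<kappa>) = of_real 1 * (Dx_symbol \<kappa> * Dx_symbol \<kappa>) +
      (of_real 1 * (Dy_symbol \<kappa> * Dy_symbol \<kappa>) + Dz_symbol \<kappa> * Dz_symbol \<kappa>)" for \<kappa>
    by (cases \<kappa>)
       (simp add: lap_eigenvalue_def Dx_symbol_def Dy_symbol_def Dz_symbol_def
          power2_eq_square algebra_simps)
  have "lap_N K f q = Dx K (Dx K f) q + Dy K (Dy K f) q + Dz K (Dz K f) q"
    by (simp add: lap_N_def div_N_def grad_N_def vector_3)
  also have "\<dots> = fourier_mult K (\<lambda>\<kappa>. - of_real (lap_eigenvalue \<kappa>)) f q"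
    unfolding symbol fourier_mult_symbol_lincomb
    by (simp add: Dx_def Dy_def Dz_def fourier_mult_compose hermitian_symbols)
  finally show "lap_N K f q = fourier_mult K (\<lambda>\<kappa>. - of_real (lap_eigenvalue \<kappa>)) f q" .
qed

lemma lap_N_dissipative: "grid_inner K g (lap_N K g) \<le> 0"
proof -
  have "grid_inner K g (lap_N K g) = grid_inner K (lap_N K g) g"
    by (simp add: grid_inner_def mult.commute)
  also have "\<dots> = (\<Sum>\<kappa>\<in>modes K. - lap_eigenvalue \<kappa> * (cmod (fourier_coeff K g \<kappa>))\<^sup>2)"
  proof -
    have "- of_real (lap_eigenvalue \<kappa>) * fourier_coeff K g \<kappa> * cnj (fourier_coeff K g \<kappa>) =
        of_real (- lap_eigenvalue \<kappa> * (cmod (fourier_coeff K g \<kappa>))\<^sup>2)" for \<kappa>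
      by (simp add: complex_norm_square mult.assoc del: of_real_power)
    then show ?thesis
      by (simp only: lap_N_fourier_mult grid_inner_fourier_mult Re_sum Re_complex_of_real)
  qed
  also have "\<dots> \<le> 0"
    by (rule sum_nonpos) (simp add: lap_eigenvalue_nonneg)
  finally show ?thesis .
qed

lemma L_N_fourier_mult:
  assumes "f \<in> grid_space K"
  shows "L_N K a f = fourier_mult K (\<lambda>\<kappa>. of_real (a + (lap_eigenvalue \<kappa>)\<^sup>2)) f"
proof
  fix q
  have "L_N K a f q = a * fourier_mult K (\<lambda>_. 1) f q +
      fourier_mult K (\<lambda>\<kappa>. - of_real (lap_eigenvalue \<kappa>) * - of_real (lap_eigenvalue \<kappa>)) f q"
    by (simp add: L_N_def fourier_mult_one[OF assms] lap_N_fourier_mult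
        fourier_mult_compose[OF hermitian_lap])
  then show "L_N K a f q = fourier_mult K (\<lambda>\<kappa>. of_real (a + (lap_eigenvalue \<kappa>)\<^sup>2)) f q"
    by (simp add: power2_eq_square flip: fourier_mult_symbol_lincomb)
qed

text \<open>The operator \<open>L\<^sub>N\<close> is the square of the self-adjoint \<open>L\<^sub>N\<^sup>1\<^sup>/\<^sup>2\<close>. Periodicity of \<open>f\<close> is what
  turns the zeroth-order term \<open>a f\<close> into a Fourier multiplier.\<close>

lemma grid_inner_L_N:
  assumes "f \<in> grid_space K" "0 \<le> a"
  shows "grid_inner K (L_N K a f) w = grid_inner K (L_N_sqrt K a f) (L_N_sqrt K a w)"
proof -
  have sq: "complex_of_real (sqrt (a + (lap_eigenvalue \<kappa>)\<^sup>2)) *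
      of_real (sqrt (a + (lap_eigenvalue \<kappa>)\<^sup>2)) =
      of_real a + (of_real (lap_eigenvalue \<kappa>))\<^sup>2" for \<kappa>
    using assms(2) by (simp flip: of_real_mult)
  have "(\<Sum>\<kappa>\<in>modes K. L_N_sqrt_symbol a \<kappa> * fourier_coeff K f \<kappa> *
        cnj (fourier_coeff K (fourier_mult K (L_N_sqrt_symbol a) w) \<kappa>)) =
      (\<Sum>\<kappa>\<in>modes K. of_real (a + (lap_eigenvalue \<kappa>)\<^sup>2) * fourier_coeff K f \<kappa> *
        cnj (fourier_coeff K w \<kappa>))"
    by (rule sum.cong[OF refl])
       (simp add: fourier_coeff_mult hermitian_symbols L_N_sqrt_symbol_def mult_ac flip: sq)
  then show ?thesis
    by (simp only: L_N_fourier_mult[OF assms(1)] L_N_sqrt_def grid_inner_fourier_mult)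
qed

lemma L_N_sqrt_extrap:
  "L_N_sqrt K a (extrap \<phi> n) = extrap (\<lambda>k. L_N_sqrt K a (\<phi> k)) n"
proof
  fix q
  have "extrap \<phi> n = (\<lambda>q. 2 * \<phi> n q + (-1) * \<phi> (n - 1) q)"
    by (simp add: extrap_def fun_eq_iff)
  then show "L_N_sqrt K a (extrap \<phi> n) q = extrap (\<lambda>k. L_N_sqrt K a (\<phi> k)) n q"
    by (simp only: L_N_sqrt_def fourier_mult_lincomb) (simp add: extrap_def)
qed

lemma L_N_sqrt_bdf2:
  "L_N_sqrt K a (bdf2 dt \<phi> n) = bdf2 dt (\<lambda>k. L_N_sqrt K a (\<phi> k)) n"
proof
  fix q
  have "bdf2 dt \<phi> n = (\<lambda>q. 3 / (2 * dt) * \<phi> (n + 1) q +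
      1 * ((- 2 / dt) * \<phi> n q + 1 / (2 * dt) * \<phi> (n - 1) q))"
    by (simp add: bdf2_def fun_eq_iff add_divide_distrib diff_divide_distrib)
  then show "L_N_sqrt K a (bdf2 dt \<phi> n) q = bdf2 dt (\<lambda>k. L_N_sqrt K a (\<phi> k)) n q"
    by (simp only: L_N_sqrt_def fourier_mult_lincomb)
       (simp add: bdf2_def add_divide_distrib diff_divide_distrib)
qed

text \<open>Mode by mode, \<open>1 + \<lambda> + \<lambda>\<^sup>2 \<le> 3 / 2 (1 + \<lambda>\<^sup>2) \<le> 3 / (2 a) (a + \<lambda>\<^sup>2)\<close>.\<close>

lemma H2_norm_le_L_N_sqrt:
  assumes f: "f \<in> grid_space K" and a: "0 < a" "a \<le> 1"
  shows "(H2_norm K f)\<^sup>2 \<le> 3 / (2 * a) * (grid_norm K 2 (L_N_sqrt K a f))\<^sup>2"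
proof -
  define c where "c \<kappa> = (cmod (fourier_coeff K f \<kappa>))\<^sup>2" for \<kappa>
  define \<Lambda> where "\<Lambda> = lap_eigenvalue"
  have "hermitian_symbol (\<lambda>_. 1)" by (simp add: hermitian_symbol_def)
  from grid_norm_fourier_mult[OF this, of K f]
  have n0: "(grid_norm K 2 f)\<^sup>2 = (\<Sum>\<kappa>\<in>modes K. c \<kappa>)"
    by (simp add: fourier_mult_one[OF f] c_def)
  have n2: "(grid_norm K 2 (lap_N K f))\<^sup>2 = (\<Sum>\<kappa>\<in>modes K. (\<Lambda> \<kappa>)\<^sup>2 * c \<kappa>)"
    unfolding lap_N_fourier_mult grid_norm_fourier_mult[OF hermitian_lap]
    by (simp add: c_def \<Lambda>_def)
  have eig: "(cmod (Dx_symbol \<kappa>))\<^sup>2 + (cmod (Dy_symbol \<kappa>))\<^sup>2 + (cmod (Dz_symbol \<kappa>))\<^sup>2 = \<Lambda> \<kappa>" for \<kappa>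
    by (cases \<kappa>)
       (simp add: \<Lambda>_def lap_eigenvalue_def Dx_symbol_def Dy_symbol_def Dz_symbol_def
          norm_mult power_mult_distrib algebra_simps)
  have "(norm (grad_N K f q))\<^sup>2 = (Dx K f q)\<^sup>2 + (Dy K f q)\<^sup>2 + (Dz K f q)\<^sup>2" for q
    by (simp add: grad_N_def power2_norm_eq_inner inner_vec_def sum_3 vector_3
        flip: power2_eq_square)
  then have "(grid_norm K 2 (grad_N K f))\<^sup>2 =
      (grid_norm K 2 (Dx K f))\<^sup>2 + (grid_norm K 2 (Dy K f))\<^sup>2 + (grid_norm K 2 (Dz K f))\<^sup>2"
    by (simp add: grid_norm_2_squared sum.distrib distrib_left)
  also have "\<dots> = (\<Sum>\<kappa>\<in>modes K. \<Lambda> \<kappa> * c \<kappa>)"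
    by (simp add: Dx_def Dy_def Dz_def grid_norm_fourier_mult hermitian_symbols c_def
        flip: eig sum.distrib distrib_right)
  finally have n1: "(grid_norm K 2 (grad_N K f))\<^sup>2 = (\<Sum>\<kappa>\<in>modes K. \<Lambda> \<kappa> * c \<kappa>)" .
  have nL: "(grid_norm K 2 (L_N_sqrt K a f))\<^sup>2 = (\<Sum>\<kappa>\<in>modes K. (a + (\<Lambda> \<kappa>)\<^sup>2) * c \<kappa>)"
    using a by (simp add: L_N_sqrt_def grid_norm_fourier_mult hermitian_symbols
        L_N_sqrt_symbol_def c_def \<Lambda>_def)
  have symbol: "1 + x + x\<^sup>2 \<le> 3 / (2 * a) * (a + x\<^sup>2)" for x :: real
  proof -
    have "0 \<le> (x - 1)\<^sup>2" by simp
    then have "1 + x + x\<^sup>2 \<le> 3 / 2 + 3 / 2 * x\<^sup>2"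
      by (simp add: power2_eq_square algebra_simps)
    also have "\<dots> \<le> 3 / 2 + 3 / (2 * a) * x\<^sup>2"
    proof -
      have "3 / 2 \<le> 3 / (2 * a)" using a by (simp add: field_simps)
      then show ?thesis by (intro add_left_mono mult_right_mono) simp_all
    qed
    also have "\<dots> = 3 / (2 * a) * (a + x\<^sup>2)" using a by (simp add: field_simps)
    finally show ?thesis .
  qed
  have "(H2_norm K f)\<^sup>2 =
      (grid_norm K 2 f)\<^sup>2 + (grid_norm K 2 (grad_N K f))\<^sup>2 + (grid_norm K 2 (lap_N K f))\<^sup>2"
    by (simp add: H2_norm_def)
  also have "\<dots> = (\<Sum>\<kappa>\<in>modes K. (1 + \<Lambda> \<kappa> + (\<Lambda> \<kappa>)\<^sup>2) * c \<kappa>)"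
    by (simp add: n0 n1 n2 sum.distrib distrib_right)
  also have "\<dots> \<le> (\<Sum>\<kappa>\<in>modes K. 3 / (2 * a) * (a + (\<Lambda> \<kappa>)\<^sup>2) * c \<kappa>)"
    by (intro sum_mono mult_right_mono symbol) (simp add: c_def)
  also have "\<dots> = 3 / (2 * a) * (grid_norm K 2 (L_N_sqrt K a f))\<^sup>2"
    by (simp only: nL sum_distrib_left mult.assoc)
  finally show ?thesis .
qed

section \<open>Dissipation of the modified energy\<close>

text \<open>The two sides differ by the square \<open>(x - 2 y + z)\<^sup>2\<close>, the numerical dissipation of BDF2.\<close>

lemma bdf2_gstable:
  fixes x y z :: real
  shows "x\<^sup>2 + (2 * x - y)\<^sup>2 - (y\<^sup>2 + (2 * y - z)\<^sup>2) \<le> 4 * (x * (3 / 2 * x - 2 * y + 1 / 2 * z))"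
proof -
  have "4 * (x * (3 / 2 * x - 2 * y + 1 / 2 * z)) - (x\<^sup>2 + (2 * x - y)\<^sup>2 - (y\<^sup>2 + (2 * y - z)\<^sup>2))
      = (x - 2 * y + z)\<^sup>2"
    by (simp add: power2_eq_square algebra_simps)
  moreover have "0 \<le> (x - 2 * y + z)\<^sup>2" by simp
  ultimately show ?thesis by linarith
qed

lemma grid_bdf2_gstable:
  assumes "dt > 0"
  shows "(grid_norm K 2 (\<psi> (n + 1)))\<^sup>2 + (grid_norm K 2 (extrap \<psi> (n + 1)))\<^sup>2
       - ((grid_norm K 2 (\<psi> n))\<^sup>2 + (grid_norm K 2 (extrap \<psi> n))\<^sup>2)
     \<le> 4 * dt * grid_inner K (\<psi> (n + 1)) (bdf2 dt \<psi> n)"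
proof -
  let ?x = "\<lambda>q. \<psi> (n + 1) q" and ?y = "\<lambda>q. \<psi> n q" and ?z = "\<lambda>q. \<psi> (n - 1) q"
  have h: "0 \<le> mesh K ^ 3" using gridN_pos[of K] by (simp add: mesh_def)
  have "(grid_norm K 2 (\<psi> (n + 1)))\<^sup>2 + (grid_norm K 2 (extrap \<psi> (n + 1)))\<^sup>2
       - ((grid_norm K 2 (\<psi> n))\<^sup>2 + (grid_norm K 2 (extrap \<psi> n))\<^sup>2) =
      mesh K ^ 3 * (\<Sum>q\<in>cell K. (?x q)\<^sup>2 + (2 * ?x q - ?y q)\<^sup>2
        - ((?y q)\<^sup>2 + (2 * ?y q - ?z q)\<^sup>2))"
    by (simp add: grid_norm_2_squared extrap_def sum.distrib sum_subtractf distrib_left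
        right_diff_distrib)
  also have "\<dots> \<le> mesh K ^ 3 * (\<Sum>q\<in>cell K. 4 * (?x q * (3 / 2 * ?x q - 2 * ?y q + 1 / 2 * ?z q)))"
    by (intro mult_left_mono sum_mono bdf2_gstable h)
  also have "\<dots> = 4 * dt * grid_inner K (\<psi> (n + 1)) (bdf2 dt \<psi> n)"
  proof -
    have "4 * (?x q * (3 / 2 * ?x q - 2 * ?y q + 1 / 2 * ?z q)) =
        4 * dt * (?x q * bdf2 dt \<psi> n q)" for q
      using assms by (simp add: bdf2_def)
    then show ?thesis
      by (simp only:) (simp add: grid_inner_def sum_distrib_left mult_ac)
  qed
  finally show ?thesis .
qed

definition sav_energy :: "nat \<Rightarrow> real \<Rightarrow> (int \<Rightarrow> idx \<Rightarrow> real) \<Rightarrow> (int \<Rightarrow> real) \<Rightarrow> int \<Rightarrow> real" where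
  "sav_energy K a \<phi> r n =
     1 / 4 * ((grid_norm K 2 (L_N_sqrt K a (\<phi> n)))\<^sup>2
              + (grid_norm K 2 (L_N_sqrt K a (extrap \<phi> n)))\<^sup>2)
     + 1 / 2 * ((r n)\<^sup>2 + (2 * r n - r (n - 1))\<^sup>2)"

text \<open>Testing the first equation with the chemical potential \<open>\<mu>\<close> makes the nonlinearity
  disappear: by the second equation, \<open>\<langle>N\<^sub>N, w\<rangle> / sqrt E\<^sub>1\<close> is twice the BDF2 difference quotient
  of \<open>r\<close>, so that its product with \<open>r\<^sup>n\<^sup>+\<^sup>1\<close> is an energy difference up to dissipation.\<close>

lemma sav_energy_step:
  assumes step: "sav_step K a dt \<phi> r n" and dt: "dt > 0" and a: "0 \<le> a"
  shows "sav_energy K a \<phi> r (n + 1) \<le> sav_energy K a \<phi> r n"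
proof -
  define s where "s = sqrt (E1_N K (extrap \<phi> n))"
  define Nl where "Nl = N_N K (extrap \<phi> n)"
  define w where "w = bdf2 dt \<phi> n"
  define dr where "dr = 3 / 2 * r (n + 1) - 2 * r n + 1 / 2 * r (n - 1)"
  define \<mu> where "\<mu> = (\<lambda>p. r (n + 1) / s * Nl p + 1 * L_N K a (\<phi> (n + 1)) p)"
  define \<psi> where "\<psi> k = L_N_sqrt K a (\<phi> k)" for k
  have grid: "\<phi> (n + 1) \<in> grid_space K"
    and w_eq: "w = lap_N K \<mu>"
    and r_eq: "dr / dt = 1 / (2 * s) * grid_inner K Nl w"
    using step by (simp_all add: sav_step_def s_def Nl_def w_def dr_def \<mu>_def fun_eq_iff)
  have nonlinear: "r (n + 1) / s * grid_inner K Nl w = 2 * r (n + 1) * (dr / dt)"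
    by (simp add: r_eq)
  have linear: "grid_inner K (L_N K a (\<phi> (n + 1))) w = grid_inner K (\<psi> (n + 1)) (bdf2 dt \<psi> n)"
    by (simp add: grid_inner_L_N[OF grid a] w_def L_N_sqrt_bdf2 \<psi>_def[abs_def])
  have "2 * r (n + 1) * (dr / dt) + grid_inner K (\<psi> (n + 1)) (bdf2 dt \<psi> n) = grid_inner K \<mu> w"
    unfolding \<mu>_def grid_inner_lincomb_left nonlinear linear by simp
  also have "\<dots> \<le> 0"
    unfolding w_eq by (rule lap_N_dissipative)
  finally have "dt * (2 * r (n + 1) * (dr / dt) + grid_inner K (\<psi> (n + 1)) (bdf2 dt \<psi> n)) \<le> 0"
    using dt by (simp add: mult_nonneg_nonpos)
  then have diss: "2 * (r (n + 1) * dr) + dt * grid_inner K (\<psi> (n + 1)) (bdf2 dt \<psi> n) \<le> 0"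
    using dt by (simp add: distrib_left mult_ac)
  have energy: "sav_energy K a \<phi> r k =
      1 / 4 * ((grid_norm K 2 (\<psi> k))\<^sup>2 + (grid_norm K 2 (extrap \<psi> k))\<^sup>2)
      + 1 / 2 * ((r k)\<^sup>2 + (2 * r k - r (k - 1))\<^sup>2)" for k
    by (simp add: sav_energy_def L_N_sqrt_extrap \<psi>_def[abs_def])
  have "(r (n + 1))\<^sup>2 + (2 * r (n + 1) - r n)\<^sup>2 - ((r n)\<^sup>2 + (2 * r n - r (n - 1))\<^sup>2)
      \<le> 4 * (r (n + 1) * dr)"
    unfolding dr_def by (rule bdf2_gstable)
  with diss grid_bdf2_gstable[OF dt, of K \<psi> n] show ?thesis
    unfolding energy add_diff_cancel_right' distrib_left mult.assoc by linarith
qed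

lemma sav_energy_le_initial:
  assumes "\<And>n. n \<ge> 0 \<Longrightarrow> sav_step K a dt \<phi> r n" "dt > 0" "0 \<le> a" "m \<ge> 0"
  shows "sav_energy K a \<phi> r m \<le> sav_energy K a \<phi> r 0"
  using assms(4)
proof (induction m rule: int_ge_induct)
  case (step n)
  then show ?case
    using sav_energy_step[OF assms(1) assms(2,3), of n] by linarith
qed simp

section \<open>The uniform bound\<close>

theorem corollary3p2:
  fixes \<epsilon> a C0 :: real
  assumes "0 < \<epsilon>" and "\<epsilon> < 1" and "a = 1 - \<epsilon>"
  shows "\<exists>C1>0. \<forall>(K::nat) (dt::real) (\<phi> :: int \<Rightarrow> idx \<Rightarrow> real) (r :: int \<Rightarrow> real).
     dt > 0 \<longrightarrow>
     sav_solution K a dt \<phi> r \<longrightarrow>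
     1 / 4 * ((grid_norm K 2 (L_N_sqrt K a (\<phi> 0)))\<^sup>2
              + (grid_norm K 2 (L_N_sqrt K a (\<lambda>q. 2 * \<phi> 0 q - \<phi> (-1) q)))\<^sup>2)
       + 1 / 2 * (\<bar>r 0\<bar>\<^sup>2 + \<bar>2 * r 0 - r (-1)\<bar>\<^sup>2) \<le> C0 \<longrightarrow>
     (\<forall>m\<ge>1. H2_norm K (\<phi> m) \<le> C1)"
proof -
  have a: "0 < a" "a \<le> 1" using assms by auto
  \<comment> \<open>The bound is \<open>sqrt (6 C0 / a)\<close>; the absolute value and the \<open>1\<close> make the witness positive
    for every real \<open>C0\<close>.\<close>
  define C1 where "C1 = sqrt (6 * \<bar>C0\<bar> / a) + 1"
  have "C1 > 0"
    using a by (simp add: C1_def add_nonneg_pos)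
  moreover have "H2_norm K (\<phi> m) \<le> C1"
    if dt: "dt > 0" and sol: "sav_solution K a dt \<phi> r"
      and init: "1 / 4 * ((grid_norm K 2 (L_N_sqrt K a (\<phi> 0)))\<^sup>2
              + (grid_norm K 2 (L_N_sqrt K a (\<lambda>q. 2 * \<phi> 0 q - \<phi> (-1) q)))\<^sup>2)
       + 1 / 2 * (\<bar>r 0\<bar>\<^sup>2 + \<bar>2 * r 0 - r (-1)\<bar>\<^sup>2) \<le> C0"
      and m: "m \<ge> 1"
    for K dt \<phi> r m
  proof -
    have steps: "sav_step K a dt \<phi> r n" if "n \<ge> 0" for n
      using sol that by (simp add: sav_solution_def)
    have grid: "\<phi> m \<in> grid_space K"
      using steps[of "m - 1"] m by (simp add: sav_step_def)
    have "sav_energy K a \<phi> r m \<le> sav_energy K a \<phi> r 0"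
      using sav_energy_le_initial[OF steps dt] a m by simp
    also have "\<dots> \<le> C0"
      using init by (simp add: sav_energy_def extrap_def[abs_def])
    finally have "sav_energy K a \<phi> r m \<le> C0" .
    moreover have "1 / 4 * (grid_norm K 2 (L_N_sqrt K a (\<phi> m)))\<^sup>2 \<le> sav_energy K a \<phi> r m"
      using zero_le_power2[of "grid_norm K 2 (L_N_sqrt K a (extrap \<phi> m))"]
        zero_le_power2[of "r m"] zero_le_power2[of "2 * r m - r (m - 1)"]
      unfolding sav_energy_def distrib_left by linarith
    ultimately have "(grid_norm K 2 (L_N_sqrt K a (\<phi> m)))\<^sup>2 \<le> 4 * \<bar>C0\<bar>"
      by linarith
    then have "3 / (2 * a) * (grid_norm K 2 (L_N_sqrt K a (\<phi> m)))\<^sup>2 \<le> 3 / (2 * a) * (4 * \<bar>C0\<bar>)"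
      using a by (intro mult_left_mono) auto
    with H2_norm_le_L_N_sqrt[OF grid a] have "(H2_norm K (\<phi> m))\<^sup>2 \<le> 6 * \<bar>C0\<bar> / a"
      by (simp add: field_simps)
    then have "H2_norm K (\<phi> m) \<le> sqrt (6 * \<bar>C0\<bar> / a)"
      by (rule real_le_rsqrt)
    then show ?thesis by (simp add: C1_def)
  qed
  ultimately show ?thesis by blast
qed

end
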